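(* Let $m\ge 2$ and let $L_1=x_1x_2\cdots x_k$ and $L_2=y_1y_2\cdots y_k$ be words over the alphabet $\{1,\dots,m\}$. Suppose there is a bijection (permutation) $b:\{1,\dots,m\}\to\{1,\dots,m\}$ with $b(x_i)=y_i$ for all $1\le i\le k$. For an $m$-ary tree $T$ with word representation $W(T)$, let $B_{L_1,L_2}(T)$ be the $m$-ary tree whose word representation is obtained from $W(T)$ by replacing every letter $i$ in every word by $b(i)$. Then $B_{L_1,L_2}$ maps the set of $m$-ary trees avoiding the pattern $P(L_1)$ to the set of $m$-ary trees avoiding the pattern $P(L_2)$, and this map is one-to-one, onto, and preserves the number of leaves. In particular, for every $n$, the number of $n$-leaf $m$-ary trees avoiding $P(L_1)$ equals the number of $n$-leaf $m$-ary trees avoiding $P(L_2)$.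
   Context: An $m$-ary tree is a rooted ordered (plane) tree in which every vertex has either $0$ children (a leaf) or exactly $m$ ordered children (an internal vertex); the children of an internal vertex are labeled $1,\dots,m$ from left to right. Any word $x_1\cdots x_j$ over $\{1,\dots,m\}$ describes a path from the root: go to the child labeled $x_1$ of the root, then to the child labeled $x_2$ of that vertex, and so on. An $m$-leaf parent is an internal vertex all of whose $m$ children are leaves. The word representation $W(T)$ of an $m$-ary tree $T$ is the set of words describing the paths from the root to the $m$-leaf parents of $T$; this set determines $T$ uniquely (the single-vertex tree corresponds to the empty set, the tree with one internal vertex to $\{\epsilon\}$), and conversely any finite set of words in which no word is a prefix of another is the word representation of a unique $m$-ary tree (the tree whose internal vertices are exactly the vertices reached by prefixes of words in the set). For a word $L$, $P(L)$ denotes the $m$-ary tree pattern with word representation $\{L\}$, i.e. the tree whose internal vertices are exactly those reached by prefixes of $L$. A tree $T$ contains a tree pattern $t$ if there is a vertex $v$ of $T$ such that, placing the root of $t$ at $v$ and matching children in order, every internal vertex of $t$ corresponds to an internal vertex of $T$ (i.e. $t$ occurs as a contiguous, rooted, ordered subtree of $T$); otherwise $T$ avoids $t$. *)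

theory Defs
  imports Main "HOL-Library.Sublist"
begin

datatype tree = Leaf | Node "tree list"

inductive_set mary_trees :: "nat \<Rightarrow> tree set" for m :: nat where
  leaf: "Leaf \<in> mary_trees m"
| node: "length ts = m \<Longrightarrow> (\<And>t. t \<in> set ts \<Longrightarrow> t \<in> mary_trees m) \<Longrightarrow> Node ts \<in> mary_trees m"

primrec num_leaves :: "tree \<Rightarrow> nat" where
  "num_leaves Leaf = 1"
| "num_leaves (Node ts) = sum_list (map num_leaves ts)"

text \<open>A vertex is identified with the word describing the path to it from the root;
  letters start at 1, list indices at 0. The result is \<open>None\<close> if the path leaves the tree.\<close>

fun subtree_at :: "tree \<Rightarrow> nat list \<Rightarrow> tree option" where
  "subtree_at t [] = Some t"
| "subtree_at Leaf (x # w) = None"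
| "subtree_at (Node ts) (x # w) =
     (if 1 \<le> x \<and> x \<le> length ts then subtree_at (ts ! (x - 1)) w else None)"

definition vertices :: "tree \<Rightarrow> nat list set" where
  "vertices T = {w. subtree_at T w \<noteq> None}"

definition internal_vertices :: "tree \<Rightarrow> nat list set" where
  "internal_vertices T = {w. \<exists>ts. subtree_at T w = Some (Node ts)}"

definition word_rep :: "tree \<Rightarrow> nat list set" where
  "word_rep T = {w. \<exists>ts. subtree_at T w = Some (Node ts) \<and> (\<forall>t \<in> set ts. t = Leaf)}"

text \<open>For \<open>m > 0\<close> this is well defined on the finite prefix-free sets of words over
  \<open>{1..m}\<close>; see \<open>ex1_tree_of_words\<close> below.\<close>

definition tree_of_words :: "nat \<Rightarrow> nat list set \<Rightarrow> tree" where
  "tree_of_words m S = (THE T. T \<in> mary_trees m \<and> word_rep T = S)"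

definition word_pattern :: "nat \<Rightarrow> nat list \<Rightarrow> tree" where
  "word_pattern m L = tree_of_words m {L}"

definition relabel :: "nat \<Rightarrow> (nat \<Rightarrow> nat) \<Rightarrow> tree \<Rightarrow> tree" where
  "relabel m b T = tree_of_words m (map b ` word_rep T)"

definition contains_pattern :: "tree \<Rightarrow> tree \<Rightarrow> bool" where
  "contains_pattern T t \<longleftrightarrow>
     (\<exists>v \<in> vertices T. \<forall>w \<in> internal_vertices t. v @ w \<in> internal_vertices T)"

definition avoiders :: "nat \<Rightarrow> tree \<Rightarrow> tree set" where
  "avoiders m t = {T \<in> mary_trees m. \<not> contains_pattern T t}"


subsection \<open>Well-definedness\<close>

definition prefix_free :: "'a list set \<Rightarrow> bool" where
  "prefix_free S \<longleftrightarrow> (\<forall>u \<in> S. \<forall>v \<in> S. prefix u v \<longrightarrow> u = v)"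

lemma Node_mary_iff:
  "Node ts \<in> mary_trees m \<longleftrightarrow> length ts = m \<and> set ts \<subseteq> mary_trees m"
  by (auto elim: mary_trees.cases intro: mary_trees.intros)

lemma word_rep_simps:
  "word_rep Leaf = {}"
  "[] \<in> word_rep (Node ts) \<longleftrightarrow> (\<forall>t \<in> set ts. t = Leaf)"
  "x # w \<in> word_rep (Node ts) \<longleftrightarrow> 1 \<le> x \<and> x \<le> length ts \<and> w \<in> word_rep (ts ! (x - 1))"
proof -
  have "w \<notin> word_rep Leaf" for w by (cases w) (auto simp: word_rep_def)
  then show "word_rep Leaf = {}" by blast
qed (auto simp: word_rep_def)

lemma word_rep_Node:
  "word_rep (Node ts) = (if \<forall>t \<in> set ts. t = Leaf then {[]} else {})
     \<union> (\<Union>x \<in> {1..length ts}. (#) x ` word_rep (ts ! (x - 1)))" (is "_ = ?R")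
proof -
  have "w \<in> word_rep (Node ts) \<longleftrightarrow> w \<in> ?R" for w
    by (cases w) (auto simp: word_rep_simps)
  then show ?thesis by blast
qed

lemma word_rep_Node_nonempty: "word_rep (Node ts) \<noteq> {}"
proof (induction "Node ts" arbitrary: ts rule: measure_induct_rule[where f = size])
  case (less ts)
  show ?case
  proof (cases "\<forall>t \<in> set ts. t = Leaf")
    case True then show ?thesis by (auto simp: word_rep_Node)
  next
    case False
    then obtain t where t: "t \<in> set ts" "t \<noteq> Leaf" by blast
    obtain us where us: "t = Node us" using \<open>t \<noteq> Leaf\<close> by (cases t) auto
    obtain i where i: "i < length ts" "ts ! i = t" using t by (auto simp: in_set_conv_nth)
    have "size (Node us) < size (Node ts)"
      using size_list_estimation'[of t ts "size t" size] t us by simp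
    then have "word_rep t \<noteq> {}" using less us by blast
    then obtain w where "w \<in> word_rep t" by blast
    then have "Suc i # w \<in> word_rep (Node ts)" using i by (simp add: word_rep_simps)
    then show ?thesis by blast
  qed
qed

lemma word_rep_inject:
  assumes "T \<in> mary_trees m" "T' \<in> mary_trees m" "word_rep T = word_rep T'"
  shows "T = T'"
  using assms
proof (induction T arbitrary: T' rule: mary_trees.induct)
  case leaf
  then show ?case using word_rep_Node_nonempty by (cases T') (auto simp: word_rep_simps)
next
  case (node ts)
  obtain ts' where T': "T' = Node ts'"
    using node.prems word_rep_Node_nonempty[of ts] by (cases T') (auto simp: word_rep_simps)
  have len: "length ts' = m" using node.prems T' by (simp add: Node_mary_iff)
  have "ts ! i = ts' ! i" if i: "i < m" for i
  proof -
    have "w \<in> word_rep (ts ! i) \<longleftrightarrow> w \<in> word_rep (ts' ! i)" for w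
      using i word_rep_simps(3)[of "Suc i" w ts] word_rep_simps(3)[of "Suc i" w ts']
        node.prems(2) T' len node.hyps(1) by simp
    moreover have "ts' ! i \<in> mary_trees m"
      using node.prems(1) T' i len by (auto simp: Node_mary_iff)
    ultimately show ?thesis using node.IH[of "ts ! i" "ts' ! i"] i node.hyps(1) by auto
  qed
  then show ?case using T' len node.hyps(1) by (auto intro: nth_equalityI)
qed

lemma ex_tree_of_words:
  assumes "m > 0" "finite S" "S \<subseteq> lists {1..m}" "prefix_free S"
  shows "\<exists>T \<in> mary_trees m. word_rep T = S"
proof -
  obtain N where "\<forall>w \<in> S. length w < N"
    using finite_nat_set_iff_bounded[of "length ` S"] assms(2) by auto
  then show ?thesis using assms(3,4)
  proof (induction N arbitrary: S)
    case 0
    then have "S = {}" by auto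
    then show ?case by (intro bexI[of _ Leaf]) (auto simp: word_rep_simps mary_trees.leaf)
  next
    case (Suc N)
    show ?case
    proof (cases "[] \<in> S")
      case True
      then have "v = []" if "v \<in> S" for v
        using that Suc.prems(3) unfolding prefix_free_def by (metis Nil_prefix)
      with True have "S = {[]}" by blast
      moreover have "Node (replicate m Leaf) \<in> mary_trees m"
        by (auto simp: Node_mary_iff mary_trees.leaf)
      moreover have "word_rep (Node (replicate m Leaf)) = {[]}"
        by (auto simp: word_rep_Node word_rep_simps)
      ultimately show ?thesis by blast
    next
      case nil: False
      show ?thesis
      proof (cases "S = {}")
        case True
        then show ?thesis by (intro bexI[of _ Leaf]) (auto simp: word_rep_simps mary_trees.leaf)
      next
        case False
        have "prefix_free {w. x # w \<in> S}" for x
          using Suc.prems(3) unfolding prefix_free_def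
          by (metis Cons_prefix_Cons list.inject mem_Collect_eq)
        then have "\<exists>T \<in> mary_trees m. word_rep T = {w. x # w \<in> S}" for x
          using Suc.prems(1,2) by (intro Suc.IH) auto
        then obtain f where f: "f x \<in> mary_trees m" "word_rep (f x) = {w. x # w \<in> S}" for x
          by metis
        let ?ts = "map (\<lambda>i. f (Suc i)) [0..<m]"
        have mem: "Node ?ts \<in> mary_trees m" using f by (auto simp: Node_mary_iff)
        obtain x u where xu: "x # u \<in> S" using False nil by (metis ex_in_conv neq_Nil_conv)
        then have x: "1 \<le> x" "x \<le> m" using Suc.prems(2) by auto
        have "f x \<noteq> Leaf" using f(2)[of x] xu by (auto simp: word_rep_simps)
        moreover have "f x \<in> set ?ts" using x by (auto intro: image_eqI[of _ _ "x - 1"])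
        ultimately have "[] \<notin> word_rep (Node ?ts)" unfolding word_rep_simps by blast
        moreover have "y # w \<in> word_rep (Node ?ts) \<longleftrightarrow> y # w \<in> S" for y w
        proof -
          have *: "w \<in> word_rep (?ts ! (y - 1)) \<longleftrightarrow> y # w \<in> S" if "1 \<le> y" "y \<le> m"
            using that f(2) by (cases y) auto
          have "1 \<le> y \<and> y \<le> m" if "y # w \<in> S"
            using that Suc.prems(2) by auto
          then show ?thesis unfolding word_rep_simps using * by (metis length_map length_upt diff_zero)
        qed
        ultimately have "w \<in> word_rep (Node ?ts) \<longleftrightarrow> w \<in> S" for w
          using nil by (cases w) auto
        then show ?thesis using mem by blast
      qed
    qed
  qed
qed

lemma ex1_tree_of_words:
  assumes "m > 0" "finite S" "S \<subseteq> lists {1..m}" "prefix_free S"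
  shows "\<exists>!T. T \<in> mary_trees m \<and> word_rep T = S"
  using ex_tree_of_words[OF assms] word_rep_inject by blast

lemma tree_of_words:
  assumes "m > 0" "finite S" "S \<subseteq> lists {1..m}" "prefix_free S"
  shows "tree_of_words m S \<in> mary_trees m" "word_rep (tree_of_words m S) = S"
  using theI'[OF ex1_tree_of_words[OF assms]] by (simp_all add: tree_of_words_def)

lemma word_rep_mary:
  assumes "T \<in> mary_trees m"
  shows "finite (word_rep T)" "word_rep T \<subseteq> lists {1..m}" "prefix_free (word_rep T)"
proof -
  have "finite (word_rep T) \<and> word_rep T \<subseteq> lists {1..m} \<and> prefix_free (word_rep T)"
    using assms
  proof (induction rule: mary_trees.induct)
    case leaf
    show ?case by (simp add: word_rep_simps prefix_free_def)
  next
    case (node ts)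
    have IH: "finite (word_rep (ts ! (x - 1)))" "word_rep (ts ! (x - 1)) \<subseteq> lists {1..m}"
      "prefix_free (word_rep (ts ! (x - 1)))" if "1 \<le> x" "x \<le> m" for x
    proof -
      have "ts ! (x - 1) \<in> set ts" using that node.hyps(1) by simp
      from node.IH[OF this] show "finite (word_rep (ts ! (x - 1)))"
        "word_rep (ts ! (x - 1)) \<subseteq> lists {1..m}" "prefix_free (word_rep (ts ! (x - 1)))" by auto
    qed
    have "finite (word_rep (Node ts))"
      using IH(1) node.hyps(1) by (auto simp: word_rep_Node)
    moreover have "w \<in> lists {1..m}" if "w \<in> word_rep (Node ts)" for w
      using that IH(2) node.hyps(1) by (cases w) (auto simp: word_rep_simps)
    moreover have "u = v" if uv: "u \<in> word_rep (Node ts)" "v \<in> word_rep (Node ts)" "prefix u v" for u v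
    proof (cases u)
      case Nil
      then have leaves: "\<forall>t \<in> set ts. t = Leaf" using that by (simp add: word_rep_simps)
      show ?thesis
      proof (cases v)
        case (Cons y w)
        then have "w \<in> word_rep (ts ! (y - 1))" "1 \<le> y" "y \<le> length ts"
          using that by (auto simp: word_rep_simps)
        moreover from this have "ts ! (y - 1) = Leaf" using leaves by simp
        ultimately show ?thesis by (simp add: word_rep_simps)
      qed (simp add: Nil)
    next
      case (Cons x u')
      then obtain v' where v: "v = x # v'" "prefix u' v'" using uv(3) by (cases v) auto
      then show ?thesis
        using that Cons IH(3)[of x] node.hyps(1) by (auto simp: word_rep_simps prefix_free_def)
    qed
    ultimately show ?case by (auto simp: prefix_free_def)
  qed
  then show "finite (word_rep T)" "word_rep T \<subseteq> lists {1..m}" "prefix_free (word_rep T)"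
    by auto
qed

lemma word_pattern:
  assumes "m > 0" "L \<in> lists {1..m}"
  shows "word_pattern m L \<in> mary_trees m" "word_rep (word_pattern m L) = {L}"
  using tree_of_words[of m "{L}"] assms by (auto simp: word_pattern_def prefix_free_def)

lemma relabel:
  assumes "m > 0" "bij_betw b {1..m} {1..m}" "T \<in> mary_trees m"
  shows "relabel m b T \<in> mary_trees m" "word_rep (relabel m b T) = map b ` word_rep T"
proof -
  note W = word_rep_mary[OF assms(3)]
  have "map b w \<in> lists {1..m}" if "w \<in> word_rep T" for w
    using that W(2) bij_betwE[OF assms(2)] by fastforce
  then have sub: "map b ` word_rep T \<subseteq> lists {1..m}" by blast
  have "u = v" if "u \<in> word_rep T" "v \<in> word_rep T" "prefix (map b u) (map b v)" for u v
  proof -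
    have "map b u = map b (take (length u) v)"
      using that(3) by (metis append_eq_conv_conj length_map prefixE take_map)
    moreover have "inj_on b (set u \<union> set (take (length u) v))"
    proof (rule inj_on_subset[OF bij_betw_imp_inj_on[OF assms(2)]])
      show "set u \<union> set (take (length u) v) \<subseteq> {1..m}"
        using that W(2) set_take_subset[of "length u" v] by (auto simp: lists_eq_set)
    qed
    ultimately have "u = take (length u) v" using map_inj_on by blast
    then have "prefix u v" by (metis take_is_prefix)
    then show ?thesis using W(3) that by (auto simp: prefix_free_def)
  qed
  then have "prefix_free (map b ` word_rep T)" unfolding prefix_free_def by blast
  with tree_of_words[OF assms(1) _ sub] W(1)
  show "relabel m b T \<in> mary_trees m" "word_rep (relabel m b T) = map b ` word_rep T"
    by (auto simp: relabel_def)
qed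

lemma internal_vertices_word_pattern:
  assumes "m > 0" "L \<in> lists {1..m}"
  shows "internal_vertices (word_pattern m L) = {w. prefix w L}"
proof -
  have sub_rep: "(\<exists>ts. subtree_at T w = Some (Node ts)) \<longleftrightarrow> (\<exists>u. w @ u \<in> word_rep T)" for T w
  proof (induction T w rule: subtree_at.induct)
    case (1 t)
    then show ?case using word_rep_Node_nonempty by (cases t) (auto simp: word_rep_simps)
  qed (auto simp: word_rep_simps)
  show ?thesis
    using word_pattern[OF assms] by (auto simp: internal_vertices_def sub_rep prefix_def)
qed

lemma finite_mary_trees_num_leaves:
  assumes "m \<ge> 2"
  shows "finite {T \<in> mary_trees m. num_leaves T = n}"
proof -
  have pos: "num_leaves T \<ge> 1" if "T \<in> mary_trees m" for T
    using that
  proof (induction rule: mary_trees.induct)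
    case (node ts)
    then obtain t where "t \<in> set ts" using assms by (cases ts) auto
    then show ?case using node.IH[of t] member_le_sum_list[of "num_leaves t" "map num_leaves ts"] by simp
  qed simp
  have child: "num_leaves t < num_leaves (Node ts)"
    if ts_m: "Node ts \<in> mary_trees m" and t: "t \<in> set ts" for t ts
  proof -
    obtain us vs where ts: "ts = us @ t # vs" using t by (meson split_list)
    then obtain s where s: "s \<in> set (us @ vs)"
      using ts_m assms by (cases "us @ vs") (auto simp: Node_mary_iff)
    then have "num_leaves s \<le> sum_list (map num_leaves (us @ vs))"
      by (intro member_le_sum_list) auto
    moreover have "num_leaves s \<ge> 1" using s ts ts_m pos by (auto simp: Node_mary_iff)
    ultimately have "1 \<le> sum_list (map num_leaves (us @ vs))" by linarith
    then show ?thesis using ts by simp arith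
  qed
  have "finite {T \<in> mary_trees m. num_leaves T \<le> n}" for n
  proof (induction n)
    case 0
    have "{T \<in> mary_trees m. num_leaves T \<le> 0} = {}" using pos by force
    then show ?case by (metis finite.emptyI)
  next
    case (Suc n)
    let ?S = "{T \<in> mary_trees m. num_leaves T \<le> n}"
    have "{T \<in> mary_trees m. num_leaves T \<le> Suc n}
        \<subseteq> insert Leaf (Node ` {ts. set ts \<subseteq> ?S \<and> length ts = m})"
    proof
      fix T assume T: "T \<in> {T \<in> mary_trees m. num_leaves T \<le> Suc n}"
      show "T \<in> insert Leaf (Node ` {ts. set ts \<subseteq> ?S \<and> length ts = m})"
      proof (cases T)
        case (Node ts)
        then have "set ts \<subseteq> ?S" "length ts = m"
          using T child[of ts] by (fastforce simp: Node_mary_iff)+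
        then show ?thesis using Node by blast
      qed simp
    qed
    then show ?case using finite_lists_length_eq[OF Suc.IH, of m] by (meson finite_imageI finite_insert finite_subset)
  qed
  from this[of n] show ?thesis by (rule rev_finite_subset) auto
qed

end

(* Containing P(L) only means that some word of W(T) has L as a factor, a property that the letterwise
   bijection b transports from L1 to L2. The inverse bijection gives the inverse map. Since the internal
   vertices are the prefixes of the words of W(T), their number is preserved; a tree with s internal
   vertices has (m - 1) s + 1 leaves, so the number of leaves is preserved as well. *)

theory Submission
  imports Defs
begin

section \<open>Internal vertices and pattern containment in terms of words\<close>

text \<open>From an internal vertex one can descend to an m-leaf parent, since
  \<open>word_rep\<close> of a \<open>Node\<close> is nonempty. Conversely, every vertex on a path
  to an internal vertex is internal.\<close>

lemma mem_internal_vertices_iff: "w \<in> internal_vertices T \<longleftrightarrow> (\<exists>u. w @ u \<in> word_rep T)"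
proof (induction T w rule: subtree_at.induct)
  case (1 t)
  then show ?case
    using word_rep_Node_nonempty by (cases t) (auto simp: internal_vertices_def word_rep_simps)
qed (auto simp: internal_vertices_def word_rep_simps)

lemma subtree_at_append_ne_None: "subtree_at T (v @ w) \<noteq> None \<Longrightarrow> subtree_at T v \<noteq> None"
  by (induction T v rule: subtree_at.induct) (auto split: if_splits)

text \<open>The internal vertices of the pattern are the prefixes of \<open>L\<close>, so an
  occurrence at \<open>v\<close> amounts to \<open>v @ L\<close> being internal, that is, to
  \<open>v @ L\<close> extending to a word of \<open>word_rep T\<close>.\<close>

lemma contains_word_pattern_iff:
  assumes "m > 0" "L \<in> lists {1..m}"
  shows "contains_pattern T (word_pattern m L) \<longleftrightarrow> (\<exists>w \<in> word_rep T. sublist L w)"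
proof
  assume "contains_pattern T (word_pattern m L)"
  then obtain v where "v @ L \<in> internal_vertices T"
    unfolding contains_pattern_def internal_vertices_word_pattern[OF assms] by blast
  then show "\<exists>w \<in> word_rep T. sublist L w"
    by (auto simp: mem_internal_vertices_iff sublist_def)
next
  assume "\<exists>w \<in> word_rep T. sublist L w"
  then obtain v u where vu: "v @ L @ u \<in> word_rep T" by (auto simp: sublist_def)
  then have "v \<in> vertices T"
    using subtree_at_append_ne_None[of T v "L @ u"] by (auto simp: vertices_def word_rep_def)
  moreover have "v @ w \<in> internal_vertices T" if "prefix w L" for w
    using that vu by (auto simp: mem_internal_vertices_iff prefix_def)
  ultimately show "contains_pattern T (word_pattern m L)"
    unfolding contains_pattern_def internal_vertices_word_pattern[OF assms] by blast
qed

lemma sublist_map_map_iff: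
  assumes "inj_on f A" "xs \<in> lists A" "ys \<in> lists A"
  shows "sublist (map f xs) (map f ys) \<longleftrightarrow> sublist xs ys"
proof
  assume "sublist (map f xs) (map f ys)"
  then obtain ps ss where "map f ys = ps @ map f xs @ ss" unfolding sublist_def by blast
  then obtain us vs where us: "ys = us @ vs" and "map f xs @ ss = map f vs"
    unfolding map_eq_append_conv by blast
  then obtain zs ws where "vs = zs @ ws" and eq: "map f xs = map f zs"
    unfolding append_eq_map_conv by blast
  with us have ys: "ys = us @ zs @ ws" by simp
  \<comment> \<open>As a factor of \<open>ys\<close>, the matched block \<open>zs\<close> has all
    its letters in \<open>A\<close>, where \<open>f\<close> can be cancelled.\<close>
  have "inj_on f (set xs \<union> set zs)"
    using assms ys by (intro inj_on_subset[OF assms(1)]) auto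
  with eq have "xs = zs" by (rule map_inj_on)
  then show "sublist xs ys" using ys by simp
qed (force simp: sublist_def)

section \<open>Leaf count as a function of the number of internal vertices\<close>

lemma internal_vertices_Leaf [simp]: "internal_vertices Leaf = {}"
  by (auto simp: mem_internal_vertices_iff word_rep_simps)

lemma internal_vertices_Node:
  "internal_vertices (Node ts) =
     insert [] (\<Union>i<length ts. (#) (Suc i) ` internal_vertices (ts ! i))" (is "_ = ?R")
proof (rule set_eqI)
  fix w
  show "w \<in> internal_vertices (Node ts) \<longleftrightarrow> w \<in> ?R"
  proof (cases w)
    case (Cons x u)
    then show ?thesis
      \<comment> \<open>The letter 0 names no child; the letter \<open>Suc i\<close> names the child
        at list index \<open>i\<close>.\<close>
      by (cases x) (force simp: internal_vertices_def)+
  qed (simp add: internal_vertices_def)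
qed

lemma finite_internal_vertices: "T \<in> mary_trees m \<Longrightarrow> finite (internal_vertices T)"
  by (induction rule: mary_trees.induct) (auto simp: internal_vertices_Node)

text \<open>If the children have s internal vertices altogether, they have (m - 1) s + m leaves. The
  root adds one internal vertex, and (m - 1)(s + 1) + 1 is the same number.\<close>

lemma num_leaves_eq_card_internal_vertices:
  assumes "m > 0" "T \<in> mary_trees m"
  shows "num_leaves T = (m - 1) * card (internal_vertices T) + 1"
  using assms(2)
proof (induction rule: mary_trees.induct)
  case leaf
  then show ?case by simp
next
  case (node ts)
  let ?c = "\<lambda>i. card (internal_vertices (ts ! i))"
  let ?U = "\<Union>i<m. (#) (Suc i) ` internal_vertices (ts ! i)"
  have U: "internal_vertices (Node ts) = insert [] ?U"
    by (simp only: internal_vertices_Node node.hyps(1))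
  have fin: "finite (internal_vertices (ts ! i))" if "i < m" for i
    using that node.hyps by (auto intro!: finite_internal_vertices[of _ m])
  have "card ?U = (\<Sum>i<m. card ((#) (Suc i) ` internal_vertices (ts ! i)))"
    \<comment> \<open>Vertices below different children differ in their first letter.\<close>
    by (intro card_UN_disjoint) (auto simp: fin)
  also have "\<dots> = (\<Sum>i<m. ?c i)"
    by (intro sum.cong) (auto intro: card_image)
  finally have "card (internal_vertices (Node ts)) = Suc (\<Sum>i<m. ?c i)"
    unfolding U using fin by (subst card_insert_disjoint) auto
  moreover have "num_leaves (Node ts) = (\<Sum>i<m. (m - 1) * ?c i + 1)"
  proof -
    have "num_leaves (Node ts) = (\<Sum>i<m. num_leaves (ts ! i))"
      by (simp add: sum_list_sum_nth atLeast0LessThan node.hyps(1))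
    also have "\<dots> = (\<Sum>i<m. (m - 1) * ?c i + 1)"
      by (intro sum.cong refl node.IH) (simp add: node.hyps(1))
    finally show ?thesis .
  qed
  then have "num_leaves (Node ts) = (m - 1) * (\<Sum>i<m. ?c i) + m"
    by (simp only: sum.distrib sum_distrib_left sum_constant card_lessThan) simp
  \<comment> \<open>Positivity of \<open>m\<close> gives \<open>(m - 1) + 1 = m\<close> under
    truncated subtraction.\<close>
  ultimately show ?case using assms(1) by (simp del: num_leaves.simps)
qed

section \<open>Relabelling and the number of leaves\<close>

lemma internal_vertices_subset_lists:
  assumes "T \<in> mary_trees m"
  shows "internal_vertices T \<subseteq> lists {1..m}"
proof
  fix w assume "w \<in> internal_vertices T"
  then obtain u where "w @ u \<in> lists {1..m}"
    using word_rep_mary(2)[OF assms] unfolding mem_internal_vertices_iff by blast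
  then show "w \<in> lists {1..m}" by simp
qed

text \<open>Taking prefixes commutes with \<open>map b\<close>.\<close>

lemma internal_vertices_relabel:
  assumes "m > 0" "bij_betw b {1..m} {1..m}" "T \<in> mary_trees m"
  shows "internal_vertices (relabel m b T) = map b ` internal_vertices T"
proof
  show "internal_vertices (relabel m b T) \<subseteq> map b ` internal_vertices T"
  proof
    fix w assume "w \<in> internal_vertices (relabel m b T)"
    then obtain u where "w @ u \<in> map b ` word_rep T"
      unfolding mem_internal_vertices_iff relabel(2)[OF assms] ..
    then obtain w' u' where "w' @ u' \<in> word_rep T" and w: "w = map b w'"
      by (auto simp: append_eq_map_conv)
    then have "w' \<in> internal_vertices T" unfolding mem_internal_vertices_iff by blast
    then show "w \<in> map b ` internal_vertices T" unfolding w by (rule imageI)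
  qed
  show "map b ` internal_vertices T \<subseteq> internal_vertices (relabel m b T)"
  proof (rule image_subsetI)
    fix w assume "w \<in> internal_vertices T"
    then obtain u where "w @ u \<in> word_rep T" unfolding mem_internal_vertices_iff ..
    then have "map b w @ map b u \<in> word_rep (relabel m b T)"
      unfolding relabel(2)[OF assms] map_append[symmetric] by (rule imageI)
    then show "map b w \<in> internal_vertices (relabel m b T)"
      unfolding mem_internal_vertices_iff ..
  qed
qed

text \<open>\<open>map b\<close> is injective on words over \<open>{1..m}\<close>, so the number of
  internal vertices is unchanged, and it determines the number of leaves.\<close>

lemma num_leaves_relabel:
  assumes "m > 0" "bij_betw b {1..m} {1..m}" "T \<in> mary_trees m"
  shows "num_leaves (relabel m b T) = num_leaves T"
proof -
  have "inj_on (map b) (internal_vertices T)"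
    by (rule inj_on_subset[OF inj_on_map_lists[OF bij_betw_imp_inj_on[OF assms(2)]]
          internal_vertices_subset_lists[OF assms(3)]])
  then show ?thesis
    by (simp add: num_leaves_eq_card_internal_vertices[OF assms(1)] assms(3) relabel(1)[OF assms]
        internal_vertices_relabel[OF assms] card_image)
qed

section \<open>Inverse relabelling and the bijection between avoiders\<close>

text \<open>Trees are determined by their words, on which \<open>c\<close> undoes \<open>b\<close>.
  Keeping \<open>c\<close> general allows both orders of composition to be instances.\<close>

lemma relabel_relabel_inverse:
  assumes "m > 0" "bij_betw b {1..m} {1..m}" "bij_betw c {1..m} {1..m}"
    and "\<And>x. x \<in> {1..m} \<Longrightarrow> c (b x) = x" and T: "T \<in> mary_trees m"
  shows "relabel m c (relabel m b T) = T"
proof (rule word_rep_inject)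
  note R = relabel[OF assms(1,2) T]
  note R' = relabel[OF assms(1,3) R(1)]
  show "relabel m c (relabel m b T) \<in> mary_trees m" by (rule R')
  have "map c (map b w) = w" if "w \<in> word_rep T" for w
    using that word_rep_mary(2)[OF T] assms(4) by (auto intro!: map_idI)
  then show "word_rep (relabel m c (relabel m b T)) = word_rep T"
    unfolding R'(2) R(2) image_image by simp
qed (rule T)

lemma contains_word_pattern_relabel:
  assumes "m > 0" "bij_betw b {1..m} {1..m}" "T \<in> mary_trees m" "L \<in> lists {1..m}"
  shows "contains_pattern (relabel m b T) (word_pattern m (map b L))
    \<longleftrightarrow> contains_pattern T (word_pattern m L)"
proof -
  have "map b L \<in> lists {1..m}"
    using assms(4) bij_betwE[OF assms(2)] by auto
  moreover have "sublist (map b L) (map b w) \<longleftrightarrow> sublist L w" if "w \<in> word_rep T" for w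
    using that word_rep_mary(2)[OF assms(3)] assms(4)
    by (intro sublist_map_map_iff[OF bij_betw_imp_inj_on[OF assms(2)]]) auto
  ultimately show ?thesis
    using assms by (simp add: contains_word_pattern_iff relabel(2))
qed

lemma relabel_mem_avoiders:
  assumes "m > 0" "bij_betw b {1..m} {1..m}" "L \<in> lists {1..m}"
    and "T \<in> avoiders m (word_pattern m L)"
  shows "relabel m b T \<in> avoiders m (word_pattern m (map b L))"
proof -
  have T: "T \<in> mary_trees m" "\<not> contains_pattern T (word_pattern m L)"
    using assms(4) by (simp_all add: avoiders_def)
  then show ?thesis
    using relabel(1)[OF assms(1,2) T(1)] contains_word_pattern_relabel[OF assms(1,2) T(1) assms(3)]
    by (simp add: avoiders_def)
qed

text \<open>Relabelling by the inverse permutation is a two-sided inverse.\<close>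

lemma bij_betw_relabel_avoiders:
  assumes "m > 0" "bij_betw b {1..m} {1..m}" "L \<in> lists {1..m}"
  shows "bij_betw (relabel m b) (avoiders m (word_pattern m L))
    (avoiders m (word_pattern m (map b L)))"
proof -
  let ?c = "inv_into {1..m} b"
  have c: "bij_betw ?c {1..m} {1..m}" using assms(2) by (rule bij_betw_inv_into)
  have cb: "?c (b x) = x" if "x \<in> {1..m}" for x
    using that by (rule bij_betw_inv_into_left[OF assms(2)])
  have bc: "b (?c x) = x" if "x \<in> {1..m}" for x
    using that by (rule bij_betw_inv_into_right[OF assms(2)])
  have bL: "map b L \<in> lists {1..m}" using assms(3) bij_betwE[OF assms(2)] by auto
  \<comment> \<open>Hence relabelling by \<open>?c\<close> sends avoiders of the pattern of
    \<open>map b L\<close> back to avoiders of the pattern of \<open>L\<close> itself.\<close>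
  have "map ?c (map b L) = L" unfolding map_map using assms(3) cb by (auto intro!: map_idI)
  then have "relabel m ?c T \<in> avoiders m (word_pattern m L)"
    if "T \<in> avoiders m (word_pattern m (map b L))" for T
    using relabel_mem_avoiders[OF assms(1) c bL that] by simp
  moreover have "T \<in> mary_trees m" if "T \<in> avoiders m t" for T t
    using that by (simp add: avoiders_def)
  ultimately show ?thesis
    using relabel_mem_avoiders[OF assms] relabel_relabel_inverse[OF assms(1,2) c cb]
      relabel_relabel_inverse[OF assms(1) c assms(2) bc]
    by (intro bij_betw_byWitness[where f' = "relabel m ?c"]) auto
qed

theorem theorem1:
  fixes m k :: nat and L1 L2 :: "nat list" and b :: "nat \<Rightarrow> nat"
  assumes "m \<ge> 2"
    and "L1 \<in> lists {1..m}" and "L2 \<in> lists {1..m}"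
    and "length L1 = k" and "length L2 = k"
    and "bij_betw b {1..m} {1..m}"
    and "\<forall>i<k. b (L1 ! i) = L2 ! i"
  shows "bij_betw (relabel m b) (avoiders m (word_pattern m L1)) (avoiders m (word_pattern m L2))
    \<and> (\<forall>T \<in> avoiders m (word_pattern m L1). num_leaves (relabel m b T) = num_leaves T)
    \<and> (\<forall>n. card {T \<in> avoiders m (word_pattern m L1). num_leaves T = n}
          = card {T \<in> avoiders m (word_pattern m L2). num_leaves T = n})"
proof -
  let ?A = "avoiders m (word_pattern m L1)" and ?B = "avoiders m (word_pattern m L2)"
  have m: "m > 0" using assms(1) by simp
  have "map b L1 = L2" using assms(4,5,7) by (auto intro: nth_equalityI)
  then have bij: "bij_betw (relabel m b) ?A ?B"
    using bij_betw_relabel_avoiders[OF m assms(6,2)] by simp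
  have leaves: "num_leaves (relabel m b T) = num_leaves T" if "T \<in> ?A" for T
    using that num_leaves_relabel[OF m assms(6)] by (simp add: avoiders_def)
  \<comment> \<open>The preimage of an \<open>n\<close>-leaf tree in \<open>?B\<close> also has
    \<open>n\<close> leaves, so the bijection restricts to each leaf number.\<close>
  have "relabel m b ` {T \<in> ?A. num_leaves T = n} = {T \<in> ?B. num_leaves T = n}" for n
    using bij_betw_imp_surj_on[OF bij] leaves by force
  then have "bij_betw (relabel m b) {T \<in> ?A. num_leaves T = n} {T \<in> ?B. num_leaves T = n}" for n
    by (intro bij_betw_subset[OF bij]) auto
  then show ?thesis using bij leaves by (blast intro: bij_betw_same_card)
qed

end
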